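(* Let $G$ be a graph and $S$ a non-empty subset of $V(G)$. Then $S(G)$ is obtained from $G$ by deleting all edges $xy$ of $G$ with $x\in S$ and $y\in V(G)\setminus S$, and adding as edges all non-edges $xy$ of $G$ with $x\in S$ and $y\in V(G)\setminus S$. Edges with both ends in $S$ or both ends in $V(G)\setminus S$ remain unchanged.
   Context: All graphs are finite, simple and undirected, with non-empty vertex set. For a graph $G$ and $v\in V(G)$, the Seidel switch $v(G)$ of $G$ by $v$ is the graph on the same vertex set obtained from $G$ by deleting all edges $vy$ with $y\in N_G(v)$ and adding all edges $vz$ with $z\in V(G)\setminus N_G(v)$, $z\neq v$; all other adjacencies are unchanged. Here $N_G(v)$ is the set of neighbors of $v$. For a subset $S=\{v_1,\dots,v_k\}\subseteq V(G)$ (with the $v_i$ distinct), $S(G):=v_k(\cdots v_2(v_1(G)))$, the graph obtained by switching successively at each vertex of $S$; this is independent of the order in which the vertices are used. *)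

theory Defs
  imports Main
begin

datatype 'a graph = Graph (verts: "'a set") (edges: "'a set set")

definition simple_graph :: "'a graph \<Rightarrow> bool" where
  "simple_graph G \<longleftrightarrow> finite (verts G) \<and> verts G \<noteq> {} \<and>
     (\<forall>e\<in>edges G. \<exists>x\<in>verts G. \<exists>y\<in>verts G. x \<noteq> y \<and> e = {x, y})"

definition neighbors :: "'a graph \<Rightarrow> 'a \<Rightarrow> 'a set" where
  "neighbors G v = {y \<in> verts G. {v, y} \<in> edges G}"

definition seidel_switch :: "'a \<Rightarrow> 'a graph \<Rightarrow> 'a graph" where
  "seidel_switch v G = Graph (verts G)
     ((edges G - {{v, y} | y. y \<in> neighbors G v})
        \<union> {{v, z} | z. z \<in> verts G - neighbors G v \<and> z \<noteq> v})"

lemma simple_graph_seidel_switch: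
  assumes "simple_graph G" "v \<in> verts G"
  shows "simple_graph (seidel_switch v G)"
  using assms unfolding simple_graph_def seidel_switch_def by auto

text \<open>Restricting neighbors to \<open>verts G\<close> makes switches commute even on ill-formed
  graphs, so that \<^const>\<open>Finite_Set.fold\<close> can be used to switch at each vertex of a set.\<close>

lemma seidel_switch_commute:
  "seidel_switch u (seidel_switch v G) = seidel_switch v (seidel_switch u G)"
proof (cases "u = v")
  case False
  have *: "e \<in> edges (seidel_switch w H) \<longleftrightarrow>
      (if \<exists>y\<in>verts H. e = {w, y} then e \<notin> edges H \<and> e \<noteq> {w} else e \<in> edges H)"
    for e w and H :: "'a graph"
    by (auto simp: seidel_switch_def neighbors_def doubleton_eq_iff)
  have V: "verts (seidel_switch w H) = verts H" for w and H :: "'a graph"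
    by (simp add: seidel_switch_def)
  show ?thesis
  proof (rule graph.expand, intro conjI set_eqI)
    fix e
    have "e \<noteq> {u}" if "\<exists>y\<in>verts G. e = {v, y}"
      using that False by (auto simp: doubleton_eq_iff)
    moreover have "e \<noteq> {v}" if "\<exists>y\<in>verts G. e = {u, y}"
      using that False by (auto simp: doubleton_eq_iff)
    ultimately show "e \<in> edges (seidel_switch u (seidel_switch v G)) \<longleftrightarrow>
          e \<in> edges (seidel_switch v (seidel_switch u G))"
      unfolding * V by argo
  qed (simp_all add: V)
qed simp

definition seidel_switch_set :: "'a set \<Rightarrow> 'a graph \<Rightarrow> 'a graph" where
  "seidel_switch_set S G = Finite_Set.fold seidel_switch G S"

text \<open>Any enumeration of \<open>S\<close> without repetition may be used, in any order.\<close>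

lemma seidel_switch_set_enum:
  assumes "distinct vs"
  shows "seidel_switch_set (set vs) G = fold seidel_switch vs G"
proof -
  interpret comp_fun_commute "seidel_switch :: 'a \<Rightarrow> _"
    by standard (simp add: fun_eq_iff seidel_switch_commute)
  show ?thesis
    using assms by (simp add: seidel_switch_set_def fold_set_fold_remdups distinct_remdups_id)
qed

end

theory Submission
  imports Defs
begin

text \<open>Switching at \<open>v\<close> toggles exactly the pairs of distinct vertices that contain \<open>v\<close>. Switching
  at every vertex of \<open>S\<close> therefore toggles a pair \<open>x \<noteq> y\<close> once for each of its ends in \<open>S\<close>.
  Two toggles cancel, so the adjacency of \<open>x\<close> and \<open>y\<close> changes in the end iff exactly one of them
  lies in \<open>S\<close>. This parity count is the induction in \<open>edge_seidel_switch_set_iff\<close>; there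
  ``exactly one'' is written as an inequality of truth values, that is, as exclusive or. Since a
  simple graph is determined by the adjacency of its distinct vertices, the count also determines
  the whole switched graph.\<close>

lemma simple_graph_edge_neq: "simple_graph G \<Longrightarrow> {x, y} \<in> edges G \<Longrightarrow> x \<noteq> y"
  by (fastforce simp: simple_graph_def doubleton_eq_iff)

lemma simple_graph_eqI:
  assumes "simple_graph G" "simple_graph H" "verts G = verts H"
    and adj: "\<And>x y. x \<in> verts G \<Longrightarrow> y \<in> verts G \<Longrightarrow> x \<noteq> y \<Longrightarrow>
      {x, y} \<in> edges G \<longleftrightarrow> {x, y} \<in> edges H"
  shows "G = H"
proof -
  have "edges G = edges H"
  proof (rule set_eqI)
    fix e
    show "e \<in> edges G \<longleftrightarrow> e \<in> edges H"
      using assms(1-3) adj unfolding simple_graph_def by metis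
  qed
  then show ?thesis
    using assms(3) by (rule graph.expand[OF conjI, rotated])
qed

lemma verts_seidel_switch [simp]: "verts (seidel_switch v G) = verts G"
  by (simp add: seidel_switch_def)

lemma edge_seidel_switch_iff:
  assumes "x \<in> verts G" "y \<in> verts G" "x \<noteq> y"
  shows "{x, y} \<in> edges (seidel_switch v G) \<longleftrightarrow>
    ({x, y} \<in> edges G) \<noteq> ((x = v) \<noteq> (y = v))"
proof -
  have "{x, y} \<in> edges G \<longleftrightarrow> {y, x} \<in> edges G"
    by (simp add: insert_commute)
  with assms show ?thesis
    by (auto simp: seidel_switch_def neighbors_def doubleton_eq_iff)
qed

lemma seidel_switch_set_empty [simp]: "seidel_switch_set {} G = G"
  by (simp add: seidel_switch_set_def)

lemma seidel_switch_set_insert: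
  assumes "finite S" "v \<notin> S"
  shows "seidel_switch_set (insert v S) G = seidel_switch v (seidel_switch_set S G)"
proof -
  interpret comp_fun_commute "seidel_switch :: 'a \<Rightarrow> _"
    by standard (simp add: fun_eq_iff seidel_switch_commute)
  show ?thesis
    using assms by (simp add: seidel_switch_set_def)
qed

lemma verts_seidel_switch_set [simp]:
  "finite S \<Longrightarrow> verts (seidel_switch_set S G) = verts G"
  by (induction S rule: finite_induct) (simp_all add: seidel_switch_set_insert)

lemma simple_graph_seidel_switch_set:
  assumes "finite S" "simple_graph G" "S \<subseteq> verts G"
  shows "simple_graph (seidel_switch_set S G)"
  using assms
  by (induction S rule: finite_induct)
    (simp_all add: seidel_switch_set_insert simple_graph_seidel_switch)

text \<open>The new vertex \<open>v\<close> lies outside \<open>S\<close>, so inserting it flips the truth value of \<open>x \<in> S\<close>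
  precisely when \<open>x = v\<close>, and likewise for \<open>y\<close>. These are the flips that the switch at \<open>v\<close>
  applies to the adjacency of \<open>x\<close> and \<open>y\<close>.\<close>

lemma edge_seidel_switch_set_iff:
  assumes "finite S" "x \<in> verts G" "y \<in> verts G" "x \<noteq> y"
  shows "{x, y} \<in> edges (seidel_switch_set S G) \<longleftrightarrow>
    ({x, y} \<in> edges G) \<noteq> ((x \<in> S) \<noteq> (y \<in> S))"
  using assms(1)
proof (induction S rule: finite_induct)
  case (insert v S)
  then show ?case
    using assms(2-4) by (auto simp: seidel_switch_set_insert edge_seidel_switch_iff)
qed simp

theorem theorem2p6:
  fixes G :: "'a graph" and S :: "'a set"
  assumes "simple_graph G" and "S \<subseteq> verts G" and "S \<noteq> {}"
  shows "seidel_switch_set S G = Graph (verts G)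
           ((edges G - {{x, y} | x y. x \<in> S \<and> y \<in> verts G - S \<and> {x, y} \<in> edges G})
              \<union> {{x, y} | x y. x \<in> S \<and> y \<in> verts G - S \<and> {x, y} \<notin> edges G})
       \<and> (\<forall>x y. (x \<in> S \<and> y \<in> S) \<or> (x \<in> verts G - S \<and> y \<in> verts G - S) \<longrightarrow>
            ({x, y} \<in> edges (seidel_switch_set S G) \<longleftrightarrow> {x, y} \<in> edges G))"
    (is "_ = ?H \<and> _")
proof (intro conjI allI impI)
  have fin: "finite S"
    using assms(1,2) by (auto simp: simple_graph_def intro: finite_subset)
  have simple: "simple_graph (seidel_switch_set S G)"
    using fin assms(1,2) by (rule simple_graph_seidel_switch_set)
  show "seidel_switch_set S G = ?H"
  proof (rule simple_graph_eqI)
    show "simple_graph ?H"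
      unfolding simple_graph_def
    proof (intro conjI ballI)
      fix e
      assume "e \<in> edges ?H"
      then consider "e \<in> edges G" | u w where "u \<in> S" "w \<in> verts G - S" "e = {u, w}"
        by auto
      then show "\<exists>u\<in>verts ?H. \<exists>w\<in>verts ?H. u \<noteq> w \<and> e = {u, w}"
      proof cases
        case 1
        then show ?thesis
          using assms(1) by (simp add: simple_graph_def)
      next
        case 2
        then have "u \<in> verts ?H" "w \<in> verts ?H" "u \<noteq> w"
          using assms(2) by auto
        with \<open>e = {u, w}\<close> show ?thesis
          by blast
      qed
    qed (use assms(1) in \<open>simp_all add: simple_graph_def\<close>)
    fix x y
    assume "x \<in> verts (seidel_switch_set S G)" "y \<in> verts (seidel_switch_set S G)" "x \<noteq> y"
    then have xy: "x \<in> verts G" "y \<in> verts G" "x \<noteq> y"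
      using fin by simp_all
    have "{x, y} \<in> edges G \<longleftrightarrow> {y, x} \<in> edges G"
      by (simp add: insert_commute)
    then show "{x, y} \<in> edges (seidel_switch_set S G) \<longleftrightarrow> {x, y} \<in> edges ?H"
      unfolding edge_seidel_switch_set_iff[OF fin xy]
      using xy by (auto simp: doubleton_eq_iff)
  qed (use simple fin in simp_all)
  fix x y
  assume same_side: "(x \<in> S \<and> y \<in> S) \<or> (x \<in> verts G - S \<and> y \<in> verts G - S)"
  show "{x, y} \<in> edges (seidel_switch_set S G) \<longleftrightarrow> {x, y} \<in> edges G"
  proof (cases "x = y")
    case True
    \<comment> \<open>The parity count says nothing about \<open>{x, x}\<close>, but neither graph has loops.\<close>
    then show ?thesis
      using simple_graph_edge_neq[OF simple] simple_graph_edge_neq[OF assms(1)] by metis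
  next
    case False
    then show ?thesis
      using same_side assms(2) by (subst edge_seidel_switch_set_iff[OF fin]) auto
  qed
qed

end
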